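(* There exists a principal ideal $(\xi)$, $\xi \in \text{c}_{\text{o}}^*$, for which $(\omega^{1/2})_{a^2}\subset (\xi)_{a^2}$ but $(\omega^{1/2})_{a}\not\subset (\xi)_{a}$.
   Context: $H$ is an infinite-dimensional separable complex Hilbert space and $B(H)$ is the algebra of bounded operators on it. $\text{c}_{\text{o}}^*$ is the set of nonnegative real sequences $\xi = (\xi_n)_{n\ge 1}$ that are nonincreasing and converge to $0$. For $m \in \mathbb N$, the ampliation $D_m\xi$ is the sequence in which each entry of $\xi$ is repeated $m$ times. A characteristic set is a positive cone $\Sigma \subset \text{c}_{\text{o}}^*$ (closed under sums and nonnegative scalar multiples) that is hereditary ($0\le\eta \le \xi\in\Sigma$, $\eta\in \text{c}_{\text{o}}^*$, implies $\eta \in \Sigma$) and invariant under all $D_m$. By Calkin's theorem, $I \mapsto \Sigma(I) := \{s(X) \mid X \in I\}$, with $s(X)$ the sequence of $s$-numbers (singular values) of $X$ in decreasing order with multiplicity, completed by zeros if $X$ has finite rank, is an order-preserving bijection from the (proper, two-sided) ideals of $B(H)$ onto the characteristic sets; "ideal" means such an ideal. For $\xi\in \text{c}_{\text{o}}^*$, $(\xi_a)_n := \frac1n\sum_{j=1}^n \xi_j$. The arithmetic mean ideal $I_a$ of an ideal $I$ is the ideal with $\Sigma(I_a) = \{\xi \in \text{c}_{\text{o}}^* \mid \xi = O(\eta_a) \text{ for some } \eta\in\Sigma(I)\}$, and $I_{a^2} := (I_a)_a$. A principal ideal is an ideal $(\xi)$ with $\xi \in \text{c}_{\text{o}}^*$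 and $\Sigma((\xi)) = \{\eta\in\text{c}_{\text{o}}^* \mid \eta = O(D_m\xi)\text{ for some } m \in \mathbb N\}$ (the ideal generated by the diagonal operator with entries $\xi_n$). $\omega = \langle 1/n\rangle$ is the harmonic sequence, and $\omega^{1/2} = \langle n^{-1/2}\rangle$. *)

theory Defs
  imports "HOL-Analysis.Analysis"
begin

section \<open>Complex Hilbert spaces\<close>

class complex_hilbert_space = banach +
  fixes scaleC :: "complex \<Rightarrow> 'a \<Rightarrow> 'a"
    and cinner :: "'a \<Rightarrow> 'a \<Rightarrow> complex"
  assumes scaleC_add_right: "scaleC c (x + y) = scaleC c x + scaleC c y"
    and scaleC_add_left: "scaleC (c + d) x = scaleC c x + scaleC d x"
    and scaleC_scaleC: "scaleC c (scaleC d x) = scaleC (c * d) x"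
    and scaleC_of_real: "scaleC (complex_of_real r) x = scaleR r x"
    and cinner_commute: "cinner x y = cnj (cinner y x)"
    and cinner_add_left: "cinner (x + y) z = cinner x z + cinner y z"
    and cinner_scaleC_left: "cinner (scaleC c x) y = c * cinner x y"
    and cinner_same: "cinner x x = complex_of_real ((norm x)\<^sup>2)"

global_interpretation complex_vector:
  vector_space "scaleC :: complex \<Rightarrow> 'a \<Rightarrow> 'a::complex_hilbert_space"
proof
  show "scaleC 1 x = x" for x :: 'a
    using scaleC_of_real[of 1 x] by simp
qed (simp_all add: scaleC_add_right scaleC_add_left scaleC_scaleC)

text \<open>The Hilbert dimension is infinite iff the algebraic dimension is.\<close>

definition infinite_dimensional :: "'a::complex_hilbert_space itself \<Rightarrow> bool" where
  "infinite_dimensional _ \<longleftrightarrow> \<not> (\<exists>B::'a set. finite B \<and> complex_vector.span B = UNIV)"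


section \<open>Bounded and compact operators, singular values\<close>

definition bounded_op :: "('a::complex_hilbert_space \<Rightarrow> 'a) \<Rightarrow> bool" where
  "bounded_op X \<longleftrightarrow> bounded_linear X \<and> (\<forall>c x. X (scaleC c x) = scaleC c (X x))"

definition compact_op :: "('a::complex_hilbert_space \<Rightarrow> 'a) \<Rightarrow> bool" where
  "compact_op X \<longleftrightarrow> bounded_op X \<and> compact (closure (X ` cball 0 1))"

definition adj :: "('a::complex_hilbert_space \<Rightarrow> 'a) \<Rightarrow> 'a \<Rightarrow> 'a" where
  "adj X = (THE Y. \<forall>x y. cinner (X x) y = cinner x (Y y))"

text \<open>Sequences are indexed from 0: the value at \<open>n\<close> is the entry with index \<open>n + 1\<close>
  of the usual indexing from 1.\<close>

definition c0_star :: "(nat \<Rightarrow> real) set" where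
  "c0_star = {\<xi>. (\<forall>n. 0 \<le> \<xi> n) \<and> decseq \<xi> \<and> \<xi> \<longlonglongrightarrow> 0}"

text \<open>The singular values of \<open>X\<close> are the eigenvalues of \<open>(X\<^sup>*X)\<^sup>1\<^sup>/\<^sup>2\<close>, that is, the
  square roots of the eigenvalues of \<open>X\<^sup>*X\<close>. Their sequence is the nonincreasing null sequence
  in which every \<open>t > 0\<close> occurs as often as its multiplicity, all remaining entries being 0.
  For compact \<open>X\<close> these multiplicities are finite and such a sequence exists and is unique;
  for noncompact \<open>X\<close> the value carries no meaning.\<close>

definition singular_values :: "('a::complex_hilbert_space \<Rightarrow> 'a) \<Rightarrow> nat \<Rightarrow> real" where
  "singular_values X = (THE \<xi>. \<xi> \<in> c0_star \<and>
     (\<forall>t>0. card {n. \<xi> n = t} =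
       complex_vector.dim {v. adj X (X v) = scaleC (complex_of_real (t\<^sup>2)) v}))"


section \<open>Ideals of bounded operators and their characteristic sets\<close>

definition char_set :: "('a::complex_hilbert_space \<Rightarrow> 'a) set \<Rightarrow> (nat \<Rightarrow> real) set" where
  "char_set I = singular_values ` I"

text \<open>The inverse of Calkin's bijection from the proper two-sided ideals (all of which consist
  of compact operators) onto the characteristic sets.\<close>

definition ideal_of :: "(nat \<Rightarrow> real) set \<Rightarrow> ('a::complex_hilbert_space \<Rightarrow> 'a) set" where
  "ideal_of S = {X. compact_op X \<and> singular_values X \<in> S}"

text \<open>The bound is required at every index, not just eventually: otherwise every finitely
  supported sequence would be dominated by the zero sequence.\<close>

definition dominated :: "(nat \<Rightarrow> real) \<Rightarrow> (nat \<Rightarrow> real) \<Rightarrow> bool" where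
  "dominated \<xi> \<eta> \<longleftrightarrow> (\<exists>C. \<forall>n. \<xi> n \<le> C * \<eta> n)"

definition ampliation :: "nat \<Rightarrow> (nat \<Rightarrow> real) \<Rightarrow> nat \<Rightarrow> real" where
  "ampliation m \<xi> n = \<xi> (n div m)"

definition arith_mean :: "(nat \<Rightarrow> real) \<Rightarrow> nat \<Rightarrow> real" where
  "arith_mean \<xi> n = (\<Sum>j\<le>n. \<xi> j) / real (Suc n)"

definition principal_ideal :: "(nat \<Rightarrow> real) \<Rightarrow> ('a::complex_hilbert_space \<Rightarrow> 'a) set" where
  "principal_ideal \<xi> = ideal_of {\<eta> \<in> c0_star. \<exists>m\<ge>1. dominated \<eta> (ampliation m \<xi>)}"

definition am_ideal ::
    "('a::complex_hilbert_space \<Rightarrow> 'a) set \<Rightarrow> ('a \<Rightarrow> 'a) set" where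
  "am_ideal I = ideal_of {\<xi> \<in> c0_star. \<exists>\<eta>\<in>char_set I. dominated \<xi> (arith_mean \<eta>)}"

definition harmonic_seq :: "nat \<Rightarrow> real" where
  "harmonic_seq n = 1 / real (Suc n)"

end

theory Submission
  imports Defs
begin

text \<open>The proof turns the inclusions of ideals into pointwise estimates of sequences and then
  constructs a sequence for which these estimates hold.

  Diagonal operators realize every \<open>\<eta>\<close> in \<open>c0_star\<close> as a sequence of singular values
  (\<open>singular_values_diag_op\<close>), so on ideals of the form \<open>ideal_of S\<close> inclusion is inclusion of the
  sets \<open>S\<close> (\<open>ideal_of_subset_iff\<close>). The arithmetic mean absorbs ampliations, whence the ideals
  \<open>(\<xi>)\<^sub>a\<close> and \<open>(\<xi>)\<^sub>a\<^sub>a\<close> correspond to the sets of all sequences in \<open>c0_star\<close> that are \<open>O(\<xi>\<^sub>a)\<close> and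
  \<open>O(\<xi>\<^sub>a\<^sub>a)\<close> (\<open>am_ideal_principal_ideal\<close>, \<open>am_ideal_bigo_star\<close>). As \<open>n\<^sup>-\<^sup>1\<^sup>/\<^sup>2\<close> is equivalent to its
  own arithmetic mean, it remains to find \<open>\<xi>\<close> such that \<open>n\<^sup>-\<^sup>1\<^sup>/\<^sup>2\<close> is \<open>O(\<xi>\<^sub>a\<^sub>a)\<close> but not \<open>O(\<xi>\<^sub>a)\<close>.

  With \<open>S(n)\<close> for the partial sums of \<open>\<xi>\<close> this says that \<open>S(n)/\<surd>n\<close> is not bounded away from \<open>0\<close>,
  while the sum of \<open>S(j)/j\<close> over \<open>j \<le> n\<close> is at least a constant times \<open>\<surd>n\<close>. The sum in the second
  condition gains a logarithm wherever \<open>S\<close> is nearly constant. So \<open>S\<close> is made piecewise linear and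
  concave with long, nearly flat stretches: each begins with \<open>S\<close> far above \<open>\<surd>n\<close> and continues until
  \<open>S\<close> has fallen below \<open>\<surd>n\<close> by a large factor. The logarithmic gain makes up for this deficit
  (\<open>not_dominated_arith_mean_step_seq\<close>, \<open>sum_arith_mean_step_seq_ge\<close>).\<close>

section \<open>Inner products\<close>

lemma cnj_cinner: "cnj (cinner x y) = cinner y x"
  by (rule cinner_commute[symmetric])

lemma cinner_add_right: "cinner x (y + z) = cinner x y + cinner x z"
  by (metis cinner_add_left cinner_commute complex_cnj_add)

lemma cinner_scaleC_right: "cinner x (scaleC c y) = cnj c * cinner x y"
  by (metis cinner_commute cinner_scaleC_left complex_cnj_mult)

lemma cinner_zero_left [simp]: "cinner 0 x = 0"
  using cinner_add_left[of 0 0 x] by simp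

lemma cinner_zero_right [simp]: "cinner x 0 = 0"
  using cinner_add_right[of x 0 0] by simp

lemma cinner_diff_left: "cinner (x - y) z = cinner x z - cinner y z"
  using cinner_add_left[of "x - y" y z] by simp

lemma cinner_diff_right: "cinner x (y - z) = cinner x y - cinner x z"
  using cinner_add_right[of x "y - z" z] by simp

lemma cinner_sum_left: "cinner (\<Sum>i\<in>I. f i) y = (\<Sum>i\<in>I. cinner (f i) y)"
  by (induction I rule: infinite_finite_induct) (simp_all add: cinner_add_left)

lemma cinner_eq_zero_iff [simp]: "cinner x x = 0 \<longleftrightarrow> x = 0"
  by (simp add: cinner_same)

lemma norm_scaleC: "norm (scaleC c x) = cmod c * norm x"
proof -
  have "complex_of_real ((norm (scaleC c x))\<^sup>2) = complex_of_real ((cmod c * norm x)\<^sup>2)"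
  proof -
    have "cinner (scaleC c x) (scaleC c x) = (c * cnj c) * cinner x x"
      by (simp add: cinner_scaleC_left cinner_scaleC_right)
    then show ?thesis by (simp add: cinner_same power_mult_distrib flip: complex_norm_square)
  qed
  then have "(norm (scaleC c x))\<^sup>2 = (cmod c * norm x)\<^sup>2"
    by (simp only: of_real_eq_iff)
  then show ?thesis by (simp add: power2_eq_iff_nonneg)
qed

lemma cinner_Cauchy_Schwarz: "cmod (cinner x y) \<le> norm x * norm y"
proof (cases "y = 0")
  case False
  define c where "c = cinner x y / cinner y y"
  have yy: "cinner y y \<noteq> 0" using False by simp
  have "cinner (x - scaleC c y) (x - scaleC c y) = cinner x x - cinner x y * cnj (cinner x y) / cinner y y"
  proof -
    have "cinner (x - scaleC c y) (x - scaleC c y)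
        = cinner x x - cnj c * cinner x y - c * cinner y x + c * cnj c * cinner y y"
      by (simp add: cinner_diff_left cinner_diff_right cinner_scaleC_left cinner_scaleC_right
          algebra_simps)
    moreover have "cnj (cinner y y) = cinner y y" "cinner y x = cnj (cinner x y)"
      by (simp_all only: cnj_cinner)
    ultimately show ?thesis using yy by (simp add: c_def)
  qed
  then have "complex_of_real ((norm (x - scaleC c y))\<^sup>2)
      = complex_of_real ((norm x)\<^sup>2 - (cmod (cinner x y))\<^sup>2 / (norm y)\<^sup>2)"
    by (simp add: cinner_same flip: complex_norm_square)
  then have "(norm (x - scaleC c y))\<^sup>2 = (norm x)\<^sup>2 - (cmod (cinner x y))\<^sup>2 / (norm y)\<^sup>2"
    by (simp only: of_real_eq_iff)
  then have "(cmod (cinner x y))\<^sup>2 / (norm y)\<^sup>2 \<le> (norm x)\<^sup>2"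
    using zero_le_power2[of "norm (x - scaleC c y)"] by linarith
  then have "(cmod (cinner x y))\<^sup>2 \<le> (norm x * norm y)\<^sup>2"
    using False by (simp add: field_simps)
  then show ?thesis by (rule power2_le_imp_le) simp
qed simp

lemma bounded_linear_scaleC_right: "bounded_linear (scaleC c)"
  by (rule bounded_linear_intro[where K = "cmod c"])
    (simp_all add: scaleC_add_right scaleC_scaleC norm_scaleC mult.commute flip: scaleC_of_real)

lemma bounded_linear_scaleC_left: "bounded_linear (\<lambda>c. scaleC c x)"
  by (rule bounded_linear_intro[where K = "norm x"])
    (simp_all add: scaleC_add_left scaleC_scaleC norm_scaleC scaleR_conv_of_real flip: scaleC_of_real)

lemma bounded_linear_cinner_left: "bounded_linear (\<lambda>x. cinner x y)"
  by (rule bounded_linear_intro[where K = "norm y"])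
    (simp_all add: cinner_add_left cinner_scaleC_left cinner_Cauchy_Schwarz scaleR_conv_of_real
      flip: scaleC_of_real)

lemma adj_eqI:
  assumes "\<And>x y. cinner (X x) y = cinner x (Y y)"
  shows "adj X = Y"
  unfolding adj_def
proof (rule the_equality)
  fix Z assume Z: "\<forall>x y. cinner (X x) y = cinner x (Z y)"
  show "Z = Y"
  proof
    fix y
    have "cinner (Z y - Y y) (Z y - Y y) = 0"
      using Z assms by (simp add: cinner_diff_right)
    then show "Z y = Y y" by simp
  qed
qed (use assms in blast)


section \<open>Orthonormal sequences\<close>

definition orthonormal :: "(nat \<Rightarrow> 'a::complex_hilbert_space) \<Rightarrow> bool" where
  "orthonormal e \<longleftrightarrow> (\<forall>i j. cinner (e i) (e j) = (if i = j then 1 else 0))"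

lemma orthonormalD: "orthonormal e \<Longrightarrow> cinner (e i) (e j) = (if i = j then 1 else 0)"
  by (simp add: orthonormal_def)

lemma orthonormal_inj: "orthonormal e \<Longrightarrow> inj e"
  by (metis injI orthonormalD zero_neq_one)

lemma cinner_sum_orthonormal:
  assumes "orthonormal e" "finite F"
  shows "cinner (\<Sum>i\<in>F. scaleC (c i) (e i)) (e k) = (if k \<in> F then c k else 0)"
  using assms(2)
  by (simp add: cinner_sum_left cinner_scaleC_left orthonormalD[OF assms(1)] if_distrib[of "\<lambda>x. _ * x"]
      cong: if_cong)

lemma norm_sum_orthonormal:
  assumes "orthonormal e" "finite F"
  shows "(norm (\<Sum>i\<in>F. scaleC (c i) (e i)))\<^sup>2 = (\<Sum>i\<in>F. (cmod (c i))\<^sup>2)"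
proof -
  let ?s = "\<Sum>i\<in>F. scaleC (c i) (e i)"
  have "cinner ?s (scaleC (c i) (e i)) = complex_of_real ((cmod (c i))\<^sup>2)" if "i \<in> F" for i
    using that
    by (simp add: cinner_scaleC_right cinner_sum_orthonormal[OF assms] complex_norm_square
        mult.commute del: of_real_power)
  moreover have "cinner ?s ?s = cnj (\<Sum>i\<in>F. cinner (scaleC (c i) (e i)) ?s)"
    unfolding cinner_sum_left[symmetric] cnj_cinner ..
  then have "cinner ?s ?s = (\<Sum>i\<in>F. cinner ?s (scaleC (c i) (e i)))"
    by (simp only: cnj_sum cnj_cinner)
  ultimately have "complex_of_real ((norm ?s)\<^sup>2) = complex_of_real (\<Sum>i\<in>F. (cmod (c i))\<^sup>2)"
    by (simp add: cinner_same del: of_real_power)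
  then show ?thesis by (simp only: of_real_eq_iff)
qed

lemma Bessel_inequality:
  assumes "orthonormal e" "finite F"
  shows "(\<Sum>i\<in>F. (cmod (cinner x (e i)))\<^sup>2) \<le> (norm x)\<^sup>2"
proof -
  let ?s = "\<Sum>i\<in>F. scaleC (cinner x (e i)) (e i)"
  have orth: "cinner (x - ?s) (e k) = 0" if "k \<in> F" for k
    using that by (simp add: cinner_diff_left cinner_sum_orthonormal[OF assms])
  have "cinner (e i) (x - ?s) = 0" if "i \<in> F" for i
    using cnj_cinner[of "x - ?s" "e i"] orth[OF that] by simp
  then have s0: "cinner ?s (x - ?s) = 0"
    by (simp add: cinner_sum_left cinner_scaleC_left)
  then have s1: "cinner (x - ?s) ?s = 0"
    using cnj_cinner[of ?s "x - ?s"] by simp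
  have "cinner x x = cinner (?s + (x - ?s)) (?s + (x - ?s))" by simp
  also have "\<dots> = cinner ?s ?s + cinner (x - ?s) (x - ?s)"
    using s0 s1 by (simp only: cinner_add_left cinner_add_right) simp
  finally have "complex_of_real ((norm x)\<^sup>2) = complex_of_real ((norm ?s)\<^sup>2 + (norm (x - ?s))\<^sup>2)"
    by (simp add: cinner_same)
  then have "(norm x)\<^sup>2 = (norm ?s)\<^sup>2 + (norm (x - ?s))\<^sup>2" by (simp only: of_real_eq_iff)
  then show ?thesis using norm_sum_orthonormal[OF assms, of "\<lambda>i. cinner x (e i)"] by simp
qed

lemma independent_orthonormal:
  assumes "orthonormal e" "finite F"
  shows "complex_vector.independent (e ` F)"
proof -
  have inj: "inj_on e F" using orthonormal_inj[OF assms(1)] by (rule inj_on_subset) simp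
  show ?thesis
  proof (rule complex_vector.independent_if_scalars_zero)
    fix f x assume 0: "(\<Sum>x\<in>e ` F. scaleC (f x) x) = 0" and "x \<in> e ` F"
    then obtain k where k: "k \<in> F" "x = e k" by auto
    have "(\<Sum>i\<in>F. scaleC (f (e i)) (e i)) = 0"
      using 0 inj by (simp add: sum.reindex)
    then show "f x = 0"
      using cinner_sum_orthonormal[OF assms, of "\<lambda>i. f (e i)" k] k by simp
  qed (use assms in simp)
qed

text \<open>Gram-Schmidt: a vector outside the span of finitely many orthonormal vectors has a nonzero
  component orthogonal to them.\<close>

lemma exists_orthonormal:
  assumes "infinite_dimensional TYPE('a::complex_hilbert_space)"
  obtains e :: "nat \<Rightarrow> 'a::complex_hilbert_space" where "orthonormal e"
proof -
  define P :: "(nat \<Rightarrow> 'a) \<Rightarrow> nat \<Rightarrow> 'a \<Rightarrow> bool" where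
    "P f n r \<longleftrightarrow> cinner r r = 1 \<and> (\<forall>i<n. cinner r (f i) = 0)" for f n r
  have "\<exists>f. \<forall>n. P f n (f n)"
  proof (rule dependent_wellorder_choice)
    fix n :: nat and f :: "nat \<Rightarrow> 'a" assume prev: "\<And>y. y < n \<Longrightarrow> P f y (f y)"
    have on: "cinner (f i) (f j) = (if i = j then 1 else 0)" if "i < n" "j < n" for i j
      using prev[OF that(1)] prev[OF that(2)] that cnj_cinner[of "f j" "f i"]
      unfolding P_def by (cases i j rule: linorder_cases) auto
    have "complex_vector.span (f ` {..<n}) \<noteq> UNIV"
      using assms unfolding infinite_dimensional_def by blast
    then obtain x where x: "x \<notin> complex_vector.span (f ` {..<n})" by blast
    define s where "s = (\<Sum>i<n. scaleC (cinner x (f i)) (f i))"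
    have "s \<in> complex_vector.span (f ` {..<n})"
      unfolding s_def
      by (intro complex_vector.span_sum complex_vector.span_scale complex_vector.span_base) auto
    then have "x - s \<noteq> 0" using x by auto
    have "cinner s (f k) = (\<Sum>i<n. if i = k then cinner x (f k) else 0)" if "k < n" for k
      unfolding s_def cinner_sum_left
      by (rule sum.cong) (use on that in \<open>auto simp: cinner_scaleC_left\<close>)
    then have orth: "cinner (x - s) (f k) = 0" if "k < n" for k
      using that by (simp add: cinner_diff_left)
    define r where "r = scaleC (inverse (norm (x - s))) (x - s)"
    have "norm r = 1" using \<open>x - s \<noteq> 0\<close> by (simp add: r_def norm_scaleC norm_inverse)
    then have "P f n r"
      using orth by (simp add: P_def cinner_same) (simp add: r_def cinner_scaleC_left)
    then show "\<exists>r. P f n r" ..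
  qed (simp add: P_def)
  then obtain f where f: "\<And>n. P f n (f n)" by blast
  have "cinner (f i) (f j) = (if i = j then 1 else 0)" for i j
    using f[of i] f[of j] cnj_cinner[of "f j" "f i"]
    unfolding P_def by (cases i j rule: linorder_cases) auto
  then show thesis using that unfolding orthonormal_def by blast
qed


section \<open>Diagonal operators\<close>

lemma c0_starD:
  assumes "\<xi> \<in> c0_star"
  shows "0 \<le> \<xi> n" "decseq \<xi>" "\<xi> \<longlonglongrightarrow> 0"
  using assms by (auto simp: c0_star_def)

lemma c0_star_antimono: "\<xi> \<in> c0_star \<Longrightarrow> m \<le> n \<Longrightarrow> \<xi> n \<le> \<xi> m"
  by (simp add: c0_starD(2) decseqD)

lemma finite_level_set_c0_star:
  assumes "\<xi> \<in> c0_star" "t > 0"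
  shows "finite {n. \<xi> n = t}"
proof -
  obtain N where "\<xi> N < t"
    using order_tendstoD(2)[OF c0_starD(3)[OF assms(1)] assms(2)]
    by (auto simp: eventually_sequentially)
  then have "n < N" if "\<xi> n = t" for n
    using c0_star_antimono[OF assms(1), of N n] that by linarith
  then have "{n. \<xi> n = t} \<subseteq> {..<N}" by auto
  then show ?thesis by (rule finite_subset) simp
qed

definition diag_op :: "(nat \<Rightarrow> 'a) \<Rightarrow> (nat \<Rightarrow> real) \<Rightarrow> 'a::complex_hilbert_space \<Rightarrow> 'a" where
  "diag_op e \<eta> x = (\<Sum>n. scaleC (complex_of_real (\<eta> n) * cinner x (e n)) (e n))"

locale diagonal =
  fixes e :: "nat \<Rightarrow> 'a::complex_hilbert_space" and \<eta> :: "nat \<Rightarrow> real"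
  assumes orthonormal: "orthonormal e" and eta: "\<eta> \<in> c0_star"
begin

abbreviation trm :: "'a \<Rightarrow> nat \<Rightarrow> 'a" where
  "trm x n \<equiv> scaleC (complex_of_real (\<eta> n) * cinner x (e n)) (e n)"

text \<open>As \<open>\<eta>\<close> decreases, Bessel's inequality controls a whole segment by its first coefficient. This
  gives the convergence of the series, its boundedness and its approximation by finite sums.\<close>

lemma norm_segment: "norm (\<Sum>i\<in>{m..<n}. trm x i) \<le> \<eta> m * norm x"
proof (rule power2_le_imp_le)
  have "(norm (\<Sum>i\<in>{m..<n}. trm x i))\<^sup>2 = (\<Sum>i\<in>{m..<n}. (\<eta> i)\<^sup>2 * (cmod (cinner x (e i)))\<^sup>2)"
    by (simp add: norm_sum_orthonormal[OF orthonormal] norm_mult power_mult_distrib)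
  also have "\<dots> \<le> (\<Sum>i\<in>{m..<n}. (\<eta> m)\<^sup>2 * (cmod (cinner x (e i)))\<^sup>2)"
    by (intro sum_mono mult_right_mono power_mono) (auto simp: c0_star_antimono[OF eta] c0_starD[OF eta])
  also have "\<dots> \<le> (\<eta> m)\<^sup>2 * (norm x)\<^sup>2"
    unfolding sum_distrib_left[symmetric]
    by (intro mult_left_mono Bessel_inequality[OF orthonormal]) auto
  finally show "(norm (\<Sum>i\<in>{m..<n}. trm x i))\<^sup>2 \<le> (\<eta> m * norm x)\<^sup>2"
    by (simp add: power_mult_distrib)
qed (simp add: c0_starD[OF eta])

lemma summable_trm: "summable (trm x)"
  unfolding summable_Cauchy
proof (intro allI impI)
  fix r :: real assume "r > 0"
  have "(\<lambda>m. \<eta> m * norm x) \<longlonglongrightarrow> 0"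
    by (intro tendsto_mult_left_zero c0_starD[OF eta])
  from order_tendstoD(2)[OF this \<open>r > 0\<close>] obtain N where "\<forall>m\<ge>N. \<eta> m * norm x < r"
    unfolding eventually_sequentially ..
  then show "\<exists>N. \<forall>m\<ge>N. \<forall>n. norm (sum (trm x) {m..<n}) < r"
    by (intro exI[of _ N] allI impI) (rule le_less_trans[OF norm_segment], simp)
qed

lemma diag_op_LIMSEQ: "(\<lambda>n. \<Sum>i<n. trm x i) \<longlonglongrightarrow> diag_op e \<eta> x"
  unfolding diag_op_def by (rule summable_LIMSEQ[OF summable_trm])

lemma norm_diag_op_tail: "norm (diag_op e \<eta> x - (\<Sum>i<N. trm x i)) \<le> \<eta> N * norm x"
proof (rule Lim_bounded)
  show "(\<lambda>M. norm ((\<Sum>i<M. trm x i) - (\<Sum>i<N. trm x i)))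
      \<longlonglongrightarrow> norm (diag_op e \<eta> x - (\<Sum>i<N. trm x i))"
    by (intro tendsto_intros diag_op_LIMSEQ)
  show "\<forall>M\<ge>N. norm ((\<Sum>i<M. trm x i) - (\<Sum>i<N. trm x i)) \<le> \<eta> N * norm x"
    using sum_diff_nat_ivl[of 0 N _ "trm x"] norm_segment[of x N]
    by (simp add: atLeast0LessThan)
qed

lemma bounded_op_diag_op: "bounded_op (diag_op e \<eta>)"
proof -
  have add: "diag_op e \<eta> (x + y) = diag_op e \<eta> x + diag_op e \<eta> y" for x y
    unfolding diag_op_def suminf_add[OF summable_trm[of x] summable_trm[of y]]
    by (simp only: cinner_add_left distrib_left scaleC_add_left)
  have scale: "diag_op e \<eta> (scaleC c x) = scaleC c (diag_op e \<eta> x)" for c x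
    unfolding diag_op_def bounded_linear.suminf[OF bounded_linear_scaleC_right[of c] summable_trm[of x]]
    by (simp only: cinner_scaleC_left scaleC_scaleC mult.left_commute)
  have "norm (diag_op e \<eta> x) \<le> norm x * \<eta> 0" for x
    using norm_diag_op_tail[of x 0] by (simp add: mult.commute)
  then have "bounded_linear (diag_op e \<eta>)"
    using add scale[of "complex_of_real _"]
    by (intro bounded_linear_intro[where K = "\<eta> 0"]) (simp_all only: scaleC_of_real)
  then show ?thesis using scale by (simp add: bounded_op_def)
qed

lemma cinner_diag_op_left:
  "(\<lambda>n. complex_of_real (\<eta> n) * cinner x (e n) * cinner (e n) y) sums cinner (diag_op e \<eta> x) y"
  using bounded_linear.sums[OF bounded_linear_cinner_left[of y] summable_sums[OF summable_trm[of x]]]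
  by (simp add: diag_op_def cinner_scaleC_left)

lemma cinner_diag_op_basis: "cinner (diag_op e \<eta> x) (e k) = complex_of_real (\<eta> k) * cinner x (e k)"
proof -
  have "(\<lambda>n. complex_of_real (\<eta> n) * cinner x (e n) * cinner (e n) (e k))
      = (\<lambda>n. if n = k then complex_of_real (\<eta> n) * cinner x (e n) else 0)"
    by (auto simp: orthonormalD[OF orthonormal])
  then have "(\<lambda>n. complex_of_real (\<eta> n) * cinner x (e n) * cinner (e n) (e k))
      sums (complex_of_real (\<eta> k) * cinner x (e k))"
    using sums_single[of k "\<lambda>n. complex_of_real (\<eta> n) * cinner x (e n)"] by simp
  then show ?thesis using cinner_diag_op_left sums_unique2 by blast
qed

lemma diag_op_basis: "diag_op e \<eta> (e k) = scaleC (complex_of_real (\<eta> k)) (e k)"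
proof -
  have "trm (e k) = (\<lambda>n. if n = k then scaleC (complex_of_real (\<eta> n)) (e n) else 0)"
    by (auto simp: orthonormalD[OF orthonormal])
  then show ?thesis
    using sums_single[of k "\<lambda>n. scaleC (complex_of_real (\<eta> n)) (e n)"]
    by (simp add: diag_op_def sums_iff)
qed

lemma adj_diag_op: "adj (diag_op e \<eta>) = diag_op e \<eta>"
proof (rule adj_eqI)
  fix x y
  have "cnj (complex_of_real (\<eta> n) * cinner y (e n) * cinner (e n) x)
      = complex_of_real (\<eta> n) * cinner x (e n) * cinner (e n) y" for n
    using cinner_commute[of x "e n"] cinner_commute[of "e n" y] by simp
  moreover have "cnj (cinner (diag_op e \<eta> y) x) = cinner x (diag_op e \<eta> y)"
    by (metis cinner_commute)
  ultimately have "(\<lambda>n. complex_of_real (\<eta> n) * cinner x (e n) * cinner (e n) y)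
      sums cinner x (diag_op e \<eta> y)"
    using bounded_linear.sums[OF bounded_linear_cnj cinner_diag_op_left[of y x]] by (simp only:)
  then show "cinner (diag_op e \<eta> x) y = cinner x (diag_op e \<eta> y)"
    using cinner_diag_op_left sums_unique2 by blast
qed

text \<open>The \<open>N\<close>-th partial sum maps the unit ball into the compact set \<open>K N\<close>, and the remainder moves
  points of the unit ball by at most \<open>\<eta> N\<close>. Hence the image of the unit ball is totally bounded.\<close>

lemma compact_op_diag_op: "compact_op (diag_op e \<eta>)"
proof -
  define K where "K N = {\<Sum>i<N. scaleC (complex_of_real (\<eta> i) * c i) (e i) | c. \<forall>i. cmod (c i) \<le> 1}" for N
  have compact_K: "compact (K N)" for N
  proof (induction N)
    case 0
    have "K 0 = {0}" by (auto simp: K_def intro: exI[of _ "\<lambda>_. 0"])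
    then show ?case by simp
  next
    case (Suc N)
    let ?f = "\<lambda>(x, c). x + scaleC (complex_of_real (\<eta> N) * c) (e N)"
    have "K (Suc N) = ?f ` (K N \<times> cball 0 1)"
    proof (intro equalityI subsetI)
      fix y assume "y \<in> K (Suc N)"
      then obtain c where "\<forall>i. cmod (c i) \<le> 1"
        "y = (\<Sum>i<N. scaleC (complex_of_real (\<eta> i) * c i) (e i)) + scaleC (complex_of_real (\<eta> N) * c N) (e N)"
        by (auto simp: K_def)
      then show "y \<in> ?f ` (K N \<times> cball 0 1)"
        by (intro image_eqI[where x = "(\<Sum>i<N. scaleC (complex_of_real (\<eta> i) * c i) (e i), c N)"])
          (auto simp: K_def)
    next
      fix y assume "y \<in> ?f ` (K N \<times> cball 0 1)"
      then obtain c d where c: "\<forall>i. cmod (c i) \<le> 1" and d: "cmod d \<le> 1"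
        and y: "y = (\<Sum>i<N. scaleC (complex_of_real (\<eta> i) * c i) (e i)) + scaleC (complex_of_real (\<eta> N) * d) (e N)"
        by (auto simp: K_def)
      show "y \<in> K (Suc N)"
        unfolding K_def using c d y by (intro CollectI exI[of _ "c(N := d)"]) auto
    qed
    moreover have "continuous_on (K N \<times> cball 0 1) ?f"
      unfolding case_prod_beta
      by (intro continuous_intros bounded_linear.continuous_on[OF bounded_linear_scaleC_left])
    ultimately show ?case
      using Suc by (simp add: compact_continuous_image compact_Times)
  qed
  have "\<exists>F. finite F \<and> closure (diag_op e \<eta> ` cball 0 1) \<subseteq> (\<Union>y\<in>F. ball y r)" if "r > 0" for r
  proof -
    obtain N where N: "\<eta> N < r / 4"
      using order_tendstoD(2)[OF c0_starD(3)[OF eta], of "r / 4"] \<open>r > 0\<close>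
      by (auto simp: eventually_sequentially)
    obtain F where F: "finite F" "K N \<subseteq> (\<Union>y\<in>F. ball y (r / 4))"
      using compact_K[of N] \<open>r > 0\<close> unfolding compact_eq_totally_bounded
      by (metis divide_pos_pos zero_less_numeral)
    have "diag_op e \<eta> ` cball 0 1 \<subseteq> (\<Union>y\<in>F. cball y (r / 2))"
    proof
      fix z assume "z \<in> diag_op e \<eta> ` cball 0 1"
      then obtain x where x: "norm x \<le> 1" "z = diag_op e \<eta> x" by auto
      have "cmod (cinner x (e i)) \<le> 1" for i
        using Bessel_inequality[OF orthonormal, of "{i}" x] x(1)
        by (simp add: power2_le_iff_abs_le)
      then have "(\<Sum>i<N. trm x i) \<in> K N"
        unfolding K_def by (intro CollectI exI[of _ "\<lambda>i. cinner x (e i)"]) simp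
      then obtain y where y: "y \<in> F" "dist y (\<Sum>i<N. trm x i) < r / 4" using F by auto
      have "dist z (\<Sum>i<N. trm x i) \<le> \<eta> N * norm x"
        using norm_diag_op_tail[of x N] x(2) by (simp add: dist_norm)
      also have "\<dots> \<le> \<eta> N" using x(1) c0_starD(1)[OF eta] by (simp add: mult_left_le)
      finally have "dist y z < r / 2"
        using y(2) N dist_triangle2[of y z "\<Sum>i<N. trm x i"] by linarith
      then show "z \<in> (\<Union>y\<in>F. cball y (r / 2))" using y(1) by force
    qed
    then have "closure (diag_op e \<eta> ` cball 0 1) \<subseteq> (\<Union>y\<in>F. cball y (r / 2))"
      by (rule closure_minimal) (use F(1) in auto)
    also have "\<dots> \<subseteq> (\<Union>y\<in>F. ball y r)" using \<open>r > 0\<close> by fastforce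
    finally show ?thesis using F(1) by blast
  qed
  then have "compact (closure (diag_op e \<eta> ` cball 0 1))"
    unfolding compact_eq_totally_bounded by (simp add: complete_eq_closed)
  then show ?thesis using bounded_op_diag_op by (simp add: compact_op_def)
qed

text \<open>The coefficients of \<open>v\<close> vanish off the level set \<open>{n. \<eta> n = t}\<close>, and as \<open>t \<noteq> 0\<close> the vector
  \<open>v\<close> itself lies in the range of the operator, hence is the sum of its expansion.\<close>

lemma eigenspace_diag_op:
  assumes "t > 0"
  shows "{v. diag_op e \<eta> (diag_op e \<eta> v) = scaleC (complex_of_real (t\<^sup>2)) v}
    = complex_vector.span (e ` {n. \<eta> n = t})" (is "?E = _")
proof (rule equalityI[OF subsetI])
  fix v assume "v \<in> ?E"
  then have v: "diag_op e \<eta> (diag_op e \<eta> v) = scaleC (complex_of_real (t\<^sup>2)) v" by simp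
  have fin: "finite {n. \<eta> n = t}" by (rule finite_level_set_c0_star[OF eta assms])
  have "cinner v (e n) = 0" if "\<eta> n \<noteq> t" for n
  proof -
    have "complex_of_real ((\<eta> n)\<^sup>2) * cinner v (e n) = complex_of_real (t\<^sup>2) * cinner v (e n)"
      using arg_cong[OF v, of "\<lambda>x. cinner x (e n)"]
      unfolding cinner_diag_op_basis cinner_scaleC_left power2_eq_square of_real_mult
      by (simp only: mult.assoc)
    moreover have "(\<eta> n)\<^sup>2 \<noteq> t\<^sup>2"
      using that assms c0_starD(1)[OF eta, of n] power2_eq_iff_nonneg[of "\<eta> n" t] by linarith
    ultimately show ?thesis by (simp only: mult_cancel_right of_real_eq_iff) simp
  qed
  then have "trm (diag_op e \<eta> v) n = 0" if "n \<notin> {n. \<eta> n = t}" for n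
    using that by (simp add: cinner_diag_op_basis)
  then have "diag_op e \<eta> (diag_op e \<eta> v) = (\<Sum>n\<in>{n. \<eta> n = t}. trm (diag_op e \<eta> v) n)"
    unfolding diag_op_def[of e \<eta> "diag_op e \<eta> v"] by (intro suminf_finite[OF fin])
  also have "\<dots> \<in> complex_vector.span (e ` {n. \<eta> n = t})"
    by (intro complex_vector.span_sum complex_vector.span_scale complex_vector.span_base) auto
  finally have "scaleC (complex_of_real (t\<^sup>2)) v \<in> complex_vector.span (e ` {n. \<eta> n = t})"
    using v by simp
  from complex_vector.span_scale[OF this, of "inverse (complex_of_real (t\<^sup>2))"]
  show "v \<in> complex_vector.span (e ` {n. \<eta> n = t})"
    using assms by (simp del: of_real_power)
next
  have D_add: "diag_op e \<eta> (x + y) = diag_op e \<eta> x + diag_op e \<eta> y"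
    and D_scale: "diag_op e \<eta> (scaleC c x) = scaleC c (diag_op e \<eta> x)"
    and D0: "diag_op e \<eta> 0 = 0" for x y c
    using bounded_op_diag_op
    by (auto simp: bounded_op_def bounded_linear.linear linear_add linear_0)
  show "complex_vector.span (e ` {n. \<eta> n = t}) \<subseteq> ?E"
  proof (rule complex_vector.span_minimal)
    show "e ` {n. \<eta> n = t} \<subseteq> ?E"
      by (auto simp: diag_op_basis D_scale scaleC_scaleC power2_eq_square)
    show "complex_vector.subspace ?E"
      by (rule complex_vector.subspaceI)
        (simp_all add: D0 D_add D_scale scaleC_add_right scaleC_scaleC mult.commute)
  qed
qed

lemma dim_eigenspace_diag_op:
  assumes "t > 0"
  shows "complex_vector.dim {v. adj (diag_op e \<eta>) (diag_op e \<eta> v) = scaleC (complex_of_real (t\<^sup>2)) v}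
    = card {n. \<eta> n = t}"
proof -
  have "complex_vector.dim (complex_vector.span (e ` {n. \<eta> n = t})) = card (e ` {n. \<eta> n = t})"
    by (intro complex_vector.dim_span_eq_card_independent independent_orthonormal[OF orthonormal]
        finite_level_set_c0_star[OF eta assms])
  also have "\<dots> = card {n. \<eta> n = t}"
    by (intro card_image inj_on_subset[OF orthonormal_inj[OF orthonormal]]) simp
  finally show ?thesis by (simp only: adj_diag_op eigenspace_diag_op[OF assms])
qed

end

text \<open>At the first index where the sequences differ, the larger of the two values occurs more often
  in the sequence taking it there.\<close>

lemma card_level_set_less:
  assumes "\<xi> \<in> c0_star" "\<eta> \<in> c0_star" and less: "\<eta> n < \<xi> n"
    and before: "\<And>i. i < n \<Longrightarrow> \<xi> i = \<eta> i"
  shows "0 < \<xi> n" "card {i. \<eta> i = \<xi> n} < card {i. \<xi> i = \<xi> n}"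
proof -
  show pos: "0 < \<xi> n" using less c0_starD(1)[OF assms(2), of n] by linarith
  have "i < n" if "\<eta> i = \<xi> n" for i
    using c0_star_antimono[OF assms(2), of n i] less that by linarith
  then have "{i. \<eta> i = \<xi> n} \<subseteq> {i. \<xi> i = \<xi> n}" using before by auto
  moreover have "n \<in> {i. \<xi> i = \<xi> n}" "n \<notin> {i. \<eta> i = \<xi> n}" using less by simp_all
  ultimately have "{i. \<eta> i = \<xi> n} \<subset> {i. \<xi> i = \<xi> n}" by blast
  then show "card {i. \<eta> i = \<xi> n} < card {i. \<xi> i = \<xi> n}"
    by (rule psubset_card_mono[OF finite_level_set_c0_star[OF assms(1) pos]])
qed

lemma c0_star_eqI_card_level_sets:
  assumes "\<xi> \<in> c0_star" "\<eta> \<in> c0_star"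
    and card: "\<And>t. t > 0 \<Longrightarrow> card {n. \<xi> n = t} = card {n. \<eta> n = t}"
  shows "\<xi> = \<eta>"
proof (rule ccontr)
  assume "\<xi> \<noteq> \<eta>"
  then have ex: "\<exists>n. \<xi> n \<noteq> \<eta> n" by auto
  define n where "n = (LEAST n. \<xi> n \<noteq> \<eta> n)"
  have neq: "\<xi> n \<noteq> \<eta> n" unfolding n_def by (rule LeastI_ex[OF ex])
  have before: "\<xi> i = \<eta> i" if "i < n" for i
    using not_less_Least[OF that[unfolded n_def]] by simp
  consider "\<eta> n < \<xi> n" | "\<xi> n < \<eta> n" using neq by linarith
  then show False
  proof cases
    case 1
    from card_level_set_less[OF assms(1,2) this before] card show False by simp
  next
    case 2
    from card_level_set_less[OF assms(2,1) this before[symmetric]] card show False by simp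
  qed
qed

lemma singular_values_diag_op:
  assumes "orthonormal e" "\<eta> \<in> c0_star"
  shows "singular_values (diag_op e \<eta>) = \<eta>"
proof -
  interpret diagonal e \<eta> by standard (use assms in auto)
  show ?thesis
    unfolding singular_values_def
  proof (rule the_equality)
    show "\<eta> \<in> c0_star \<and> (\<forall>t>0. card {n. \<eta> n = t} = complex_vector.dim
        {v. adj (diag_op e \<eta>) (diag_op e \<eta> v) = scaleC (complex_of_real (t\<^sup>2)) v})"
      using eta dim_eigenspace_diag_op by simp
    show "\<xi> = \<eta>" if \<xi>: "\<xi> \<in> c0_star \<and> (\<forall>t>0. card {n. \<xi> n = t} = complex_vector.dim
        {v. adj (diag_op e \<eta>) (diag_op e \<eta> v) = scaleC (complex_of_real (t\<^sup>2)) v})" for \<xi>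
    proof (rule c0_star_eqI_card_level_sets[OF _ eta])
      show "card {n. \<xi> n = t} = card {n. \<eta> n = t}" if "t > 0" for t
        using \<xi> that dim_eigenspace_diag_op[OF that] by simp
    qed (use \<xi> in simp)
  qed
qed


section \<open>Arithmetic means of null sequences\<close>

lemma sum_c0_star_mono:
  assumes "\<xi> \<in> c0_star" "m \<le> n"
  shows "(\<Sum>j<m. \<xi> j) \<le> (\<Sum>j<n. \<xi> j)"
  using assms by (intro sum_mono2) (auto simp: c0_starD(1))

lemma arith_mean_eq: "arith_mean \<xi> n = (\<Sum>j<Suc n. \<xi> j) / real (Suc n)"
  by (simp add: arith_mean_def lessThan_Suc_atMost)

lemma le_arith_mean:
  assumes "\<xi> \<in> c0_star"
  shows "\<xi> n \<le> arith_mean \<xi> n"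
proof -
  have "(\<Sum>j\<le>n. \<xi> n) \<le> (\<Sum>j\<le>n. \<xi> j)"
    by (intro sum_mono c0_star_antimono[OF assms]) simp
  then show ?thesis by (simp add: arith_mean_def field_simps)
qed

lemma arith_mean_mono:
  assumes "\<And>n. \<xi> n \<le> C * \<eta> n"
  shows "arith_mean \<xi> n \<le> C * arith_mean \<eta> n"
  using sum_mono[of "{..n}" \<xi> "\<lambda>j. C * \<eta> j"] assms
  by (simp add: arith_mean_def divide_right_mono flip: sum_distrib_left)

lemma arith_mean_c0_star:
  assumes \<xi>: "\<xi> \<in> c0_star"
  shows "arith_mean \<xi> \<in> c0_star"
proof -
  have nonneg: "0 \<le> arith_mean \<xi> n" for n
    by (simp add: arith_mean_def sum_nonneg c0_starD(1)[OF \<xi>])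
  have "arith_mean \<xi> (Suc n) \<le> arith_mean \<xi> n" for n
  proof -
    have "\<xi> (Suc n) \<le> arith_mean \<xi> n"
      using c0_star_antimono[OF \<xi>, of n "Suc n"] le_arith_mean[OF \<xi>, of n] by simp
    then show ?thesis by (simp add: arith_mean_def field_simps)
  qed
  then have dec: "decseq (arith_mean \<xi>)" by (rule decseq_SucI)
  have "arith_mean \<xi> \<longlonglongrightarrow> 0"
  proof (rule LIMSEQ_I)
    fix r :: real assume "r > 0"
    obtain N where N: "\<xi> N < r / 2"
      using order_tendstoD(2)[OF c0_starD(3)[OF \<xi>], of "r / 2"] \<open>r > 0\<close>
      by (auto simp: eventually_sequentially)
    let ?c = "\<Sum>j<N. \<xi> j"
    have bound: "arith_mean \<xi> n \<le> ?c / real (Suc n) + r / 2" if "n \<ge> N" for n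
    proof -
      have "(\<Sum>j<Suc n. \<xi> j) = ?c + (\<Sum>j\<in>{N..<Suc n}. \<xi> j)"
        using sum.atLeastLessThan_concat[of 0 N "Suc n" \<xi>] that by (simp add: atLeast0LessThan)
      also have "(\<Sum>j\<in>{N..<Suc n}. \<xi> j) \<le> (\<Sum>j\<in>{N..<Suc n}. r / 2)"
        using N c0_star_antimono[OF \<xi>, of N] by (intro sum_mono) (meson atLeastLessThan_iff less_imp_le order_trans)
      also have "\<dots> = real (Suc n - N) * (r / 2)" by simp
      also have "\<dots> \<le> real (Suc n) * (r / 2)" using \<open>r > 0\<close> by (intro mult_right_mono) auto
      finally have "(\<Sum>j<Suc n. \<xi> j) \<le> ?c + real (Suc n) * (r / 2)" by simp
      from divide_right_mono[OF this, of "real (Suc n)"]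
      show ?thesis by (simp add: arith_mean_eq add_divide_distrib del: of_nat_Suc sum.lessThan_Suc)
    qed
    obtain K :: nat where K: "?c / (r / 2) < real K" using reals_Archimedean2 by blast
    have "norm (arith_mean \<xi> n - 0) < r" if "n \<ge> max N K" for n
    proof -
      have "?c / (r / 2) < real (Suc n)" using K that by simp
      then have "?c / real (Suc n) < r / 2"
        using \<open>r > 0\<close> by (simp add: divide_less_eq mult.commute del: of_nat_Suc)
      moreover have "arith_mean \<xi> n \<le> ?c / real (Suc n) + r / 2" using bound that by simp
      ultimately have "arith_mean \<xi> n < r" by linarith
      then show ?thesis using nonneg[of n] by simp
    qed
    then show "\<exists>no. \<forall>n\<ge>no. norm (arith_mean \<xi> n - 0) < r" by blast
  qed
  then show ?thesis using nonneg dec by (simp add: c0_star_def)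
qed

lemma arith_mean_ampliation:
  assumes "\<xi> \<in> c0_star" "m \<ge> 1"
  shows "arith_mean (ampliation m \<xi>) n \<le> real m * arith_mean \<xi> n"
proof -
  have "(\<Sum>j\<le>n. \<xi> (j div m)) \<le> (\<Sum>j<Suc n * m. \<xi> (j div m))"
  proof (rule sum_mono2)
    have "Suc n * 1 \<le> Suc n * m" using assms(2) by (rule mult_le_mono2)
    then show "{..n} \<subseteq> {..<Suc n * m}" by auto
  qed (use c0_starD(1)[OF assms(1)] in auto)
  also have "\<dots> = (\<Sum>k<Suc n. \<Sum>j\<in>{k * m..<k * m + m}. \<xi> (j div m))"
    by (rule sum.nat_group[symmetric])
  also have "\<dots> = (\<Sum>k<Suc n. \<Sum>j\<in>{k * m..<k * m + m}. \<xi> k)"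
  proof (intro sum.cong refl)
    fix j k assume "j \<in> {k * m..<k * m + m}"
    then have "j div m = k" by (intro div_nat_eqI) (auto simp: mult.commute)
    then show "\<xi> (j div m) = \<xi> k" by simp
  qed
  also have "\<dots> = real m * (\<Sum>k\<le>n. \<xi> k)"
    by (simp add: sum_distrib_left lessThan_Suc_atMost del: sum.lessThan_Suc)
  finally show ?thesis by (simp add: arith_mean_def ampliation_def divide_right_mono)
qed

lemma dominatedE:
  assumes "dominated \<xi> \<eta>" "\<And>n. 0 \<le> \<eta> n"
  obtains C where "C > 0" "\<And>n. \<xi> n \<le> C * \<eta> n"
proof -
  obtain C where C: "\<And>n. \<xi> n \<le> C * \<eta> n" using assms(1) unfolding dominated_def by blast
  have "\<xi> n \<le> max C 1 * \<eta> n" for n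
    using C[of n] mult_right_mono[OF _ assms(2), of C "max C 1" n] by linarith
  then show thesis by (intro that[of "max C 1"]) auto
qed

lemma dominated_trans:
  assumes "dominated \<xi> \<eta>" "dominated \<eta> \<zeta>" "\<And>n. 0 \<le> \<eta> n"
  shows "dominated \<xi> \<zeta>"
proof -
  obtain C where C: "C > 0" "\<And>n. \<xi> n \<le> C * \<eta> n" using dominatedE[OF assms(1,3)] by blast
  obtain D where D: "\<And>n. \<eta> n \<le> D * \<zeta> n" using assms(2) unfolding dominated_def by blast
  have "\<xi> n \<le> (C * D) * \<zeta> n" for n
    using C(2)[of n] mult_left_mono[OF D[of n], of C] C(1) unfolding mult.assoc by linarith
  then show ?thesis unfolding dominated_def by blast
qed

lemma dominated_arith_mean: "dominated \<xi> \<eta> \<Longrightarrow> dominated (arith_mean \<xi>) (arith_mean \<eta>)"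
  unfolding dominated_def using arith_mean_mono by blast


section \<open>Arithmetic mean ideals of principal ideals\<close>

text \<open>Every sequence in \<open>c0_star\<close> is realized by a diagonal operator. This is the only part of
  Calkin's correspondence that comparing ideals of the form \<open>ideal_of S\<close> depends on.\<close>

lemma char_set_ideal_of:
  assumes "infinite_dimensional TYPE('h::complex_hilbert_space)" "S \<subseteq> c0_star"
  shows "char_set (ideal_of S :: ('h \<Rightarrow> 'h) set) = S"
proof
  show "char_set (ideal_of S :: ('h \<Rightarrow> 'h) set) \<subseteq> S"
    by (auto simp: char_set_def ideal_of_def)
  show "S \<subseteq> char_set (ideal_of S :: ('h \<Rightarrow> 'h) set)"
  proof
    fix \<eta> assume "\<eta> \<in> S"
    obtain e :: "nat \<Rightarrow> 'h" where e: "orthonormal e" using exists_orthonormal[OF assms(1)] .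
    have \<eta>: "\<eta> \<in> c0_star" using assms(2) \<open>\<eta> \<in> S\<close> by blast
    have "compact_op (diag_op e \<eta>)"
      by (rule diagonal.compact_op_diag_op[OF diagonal.intro[OF e \<eta>]])
    then show "\<eta> \<in> char_set (ideal_of S :: ('h \<Rightarrow> 'h) set)"
      unfolding char_set_def ideal_of_def using singular_values_diag_op[OF e \<eta>] \<open>\<eta> \<in> S\<close>
      by (intro image_eqI[of _ _ "diag_op e \<eta>"]) simp_all
  qed
qed

lemma ideal_of_subset_iff:
  assumes "infinite_dimensional TYPE('h::complex_hilbert_space)" "S \<subseteq> c0_star" "T \<subseteq> c0_star"
  shows "(ideal_of S :: ('h \<Rightarrow> 'h) set) \<subseteq> ideal_of T \<longleftrightarrow> S \<subseteq> T"
proof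
  assume "(ideal_of S :: ('h \<Rightarrow> 'h) set) \<subseteq> ideal_of T"
  then have "char_set (ideal_of S :: ('h \<Rightarrow> 'h) set) \<subseteq> char_set (ideal_of T :: ('h \<Rightarrow> 'h) set)"
    unfolding char_set_def by (rule image_mono)
  then show "S \<subseteq> T" using assms by (simp add: char_set_ideal_of)
qed (auto simp: ideal_of_def)

text \<open>For a \<open>\<xi>\<close> of the form \<open>\<eta>\<^sub>a\<close>, this is the characteristic set of the arithmetic mean ideal of
  \<open>(\<eta>)\<close>.\<close>

definition bigo_star :: "(nat \<Rightarrow> real) \<Rightarrow> (nat \<Rightarrow> real) set" where
  "bigo_star \<xi> = {\<eta> \<in> c0_star. dominated \<eta> \<xi>}"

lemma bigo_star_subset: "bigo_star \<xi> \<subseteq> c0_star"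
  by (auto simp: bigo_star_def)

lemma am_ideal_ideal_of:
  assumes "infinite_dimensional TYPE('h::complex_hilbert_space)" "S \<subseteq> c0_star"
  shows "(am_ideal (ideal_of S) :: ('h \<Rightarrow> 'h) set)
    = ideal_of {\<xi> \<in> c0_star. \<exists>\<eta>\<in>S. dominated \<xi> (arith_mean \<eta>)}"
  unfolding am_ideal_def char_set_ideal_of[OF assms] ..

text \<open>The ampliations disappear under the arithmetic mean, because \<open>D\<^sub>m\<xi>\<close> has mean at most
  \<open>m \<xi>\<^sub>a\<close>.\<close>

lemma am_ideal_principal_ideal:
  assumes "infinite_dimensional TYPE('h::complex_hilbert_space)" and \<xi>: "\<xi> \<in> c0_star"
  shows "(am_ideal (principal_ideal \<xi>) :: ('h \<Rightarrow> 'h) set) = ideal_of (bigo_star (arith_mean \<xi>))"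
proof -
  let ?S = "{\<eta> \<in> c0_star. \<exists>m\<ge>1. dominated \<eta> (ampliation m \<xi>)}"
  have "dominated \<zeta> (arith_mean \<xi>)"
    if "\<eta> \<in> ?S" "dominated \<zeta> (arith_mean \<eta>)" for \<zeta> \<eta>
  proof -
    obtain m where \<eta>: "\<eta> \<in> c0_star" and m: "m \<ge> 1" "dominated \<eta> (ampliation m \<xi>)"
      using \<open>\<eta> \<in> ?S\<close> by blast
    have "dominated (arith_mean (ampliation m \<xi>)) (arith_mean \<xi>)"
      unfolding dominated_def using arith_mean_ampliation[OF \<xi> m(1)] by blast
    moreover have "0 \<le> arith_mean (ampliation m \<xi>) n" for n
      by (simp add: arith_mean_def ampliation_def sum_nonneg c0_starD(1)[OF \<xi>])
    ultimately have "dominated (arith_mean \<eta>) (arith_mean \<xi>)"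
      using dominated_arith_mean[OF m(2)] dominated_trans by blast
    then show ?thesis
      using dominated_trans[OF that(2)] c0_starD(1)[OF arith_mean_c0_star[OF \<eta>]] by blast
  qed
  moreover have "dominated \<xi> (ampliation 1 \<xi>)"
    unfolding dominated_def ampliation_def by (intro exI[of _ 1]) simp
  then have "\<xi> \<in> ?S" using \<xi> by blast
  ultimately have "{\<zeta> \<in> c0_star. \<exists>\<eta>\<in>?S. dominated \<zeta> (arith_mean \<eta>)} = bigo_star (arith_mean \<xi>)"
    unfolding bigo_star_def by blast
  moreover have "(am_ideal (principal_ideal \<xi>) :: ('h \<Rightarrow> 'h) set)
      = ideal_of {\<zeta> \<in> c0_star. \<exists>\<eta>\<in>?S. dominated \<zeta> (arith_mean \<eta>)}"
    unfolding principal_ideal_def by (rule am_ideal_ideal_of[OF assms(1)]) blast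
  ultimately show ?thesis by simp
qed

lemma am_ideal_bigo_star:
  assumes "infinite_dimensional TYPE('h::complex_hilbert_space)" and \<xi>: "\<xi> \<in> c0_star"
  shows "(am_ideal (ideal_of (bigo_star \<xi>)) :: ('h \<Rightarrow> 'h) set) = ideal_of (bigo_star (arith_mean \<xi>))"
proof -
  have "dominated \<zeta> (arith_mean \<xi>)"
    if "\<eta> \<in> bigo_star \<xi>" "dominated \<zeta> (arith_mean \<eta>)" for \<zeta> \<eta>
  proof -
    have \<eta>: "\<eta> \<in> c0_star" "dominated \<eta> \<xi>" using that(1) by (auto simp: bigo_star_def)
    show ?thesis
      using dominated_trans[OF that(2) dominated_arith_mean[OF \<eta>(2)]]
        c0_starD(1)[OF arith_mean_c0_star[OF \<eta>(1)]] by blast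
  qed
  moreover have "\<xi> \<in> bigo_star \<xi>"
    using \<xi> unfolding bigo_star_def dominated_def by (auto intro: exI[of _ 1])
  ultimately have "{\<zeta> \<in> c0_star. \<exists>\<eta>\<in>bigo_star \<xi>. dominated \<zeta> (arith_mean \<eta>)} = bigo_star (arith_mean \<xi>)"
    by (auto simp: bigo_star_def)
  then show ?thesis by (simp add: am_ideal_ideal_of[OF assms(1) bigo_star_subset])
qed


section \<open>The sequence of inverse square roots\<close>

lemma sqrt_harmonic: "harmonic_seq n powr (1/2) = 1 / sqrt (real (Suc n))"
  by (simp add: harmonic_seq_def powr_half_sqrt real_sqrt_divide)

lemma sqrt_harmonic_c0_star: "(\<lambda>n. harmonic_seq n powr (1/2)) \<in> c0_star"
proof -
  have "(\<lambda>n. sqrt (1 / real (Suc n))) \<longlonglongrightarrow> sqrt 0"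
    by (intro tendsto_real_sqrt LIMSEQ_Suc[OF lim_1_over_n])
  then have "(\<lambda>n. 1 / sqrt (real (Suc n))) \<longlonglongrightarrow> 0"
    by (simp add: real_sqrt_divide)
  moreover have "decseq (\<lambda>n. 1 / sqrt (real (Suc n)))"
    by (intro decseq_SucI divide_left_mono) auto
  ultimately show ?thesis unfolding c0_star_def sqrt_harmonic by simp
qed

lemma sum_inverse_sqrt_le: "(\<Sum>j<n. 1 / sqrt (real (Suc j))) \<le> 2 * sqrt (real n)"
proof (induction n)
  case (Suc n)
  let ?a = "sqrt (real n)" and ?b = "sqrt (real (Suc n))"
  have "?b > 0" "?a \<le> ?b" by simp_all
  have "0 \<le> (?b - ?a)\<^sup>2" by simp
  then have "2 * ?a * ?b + 1 \<le> 2 * (?b * ?b)"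
    by (simp add: power2_eq_square algebra_simps)
  then have "2 * ?a + 1 / ?b \<le> 2 * ?b"
    using \<open>?b > 0\<close> by (simp add: field_simps)
  then show ?case using Suc by simp
qed simp

lemma arith_mean_sqrt_harmonic_le:
  "arith_mean (\<lambda>n. harmonic_seq n powr (1/2)) n \<le> 2 * (harmonic_seq n powr (1/2))"
proof -
  have "arith_mean (\<lambda>n. harmonic_seq n powr (1/2)) n \<le> 2 * sqrt (real (Suc n)) / real (Suc n)"
    unfolding arith_mean_eq sqrt_harmonic
    by (intro divide_right_mono sum_inverse_sqrt_le) simp
  also have "\<dots> = 2 / sqrt (real (Suc n))"
    using sqrt_divide_self_eq[of "real (Suc n)"] by (simp add: divide_inverse del: of_nat_Suc)
  finally show ?thesis by (simp add: sqrt_harmonic)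
qed


section \<open>A step sequence with rare small means\<close>

text \<open>The sequence is a step function: its \<open>k\<close>-th step has height \<open>1/q\<^sub>k\<close>, where \<open>q\<^sub>k\<close> is
  \<open>inv_height k\<close>, and ends at \<open>M\<^sub>k\<close>, which is \<open>step_end k\<close>. The steps are so long that the sum up to
  \<open>M\<^sub>k\<close> is comparable to the contribution \<open>A\<^sub>k = M\<^sub>k/q\<^sub>k\<close> of the last step alone.

  The two factors linking \<open>q\<^sub>k\<close> to \<open>q\<^sub>k\<^sub>+\<^sub>1\<close> play different roles. Since
  \<open>A\<^sub>k\<^sup>2 = 2\<^sup>k\<^sup>+\<^sup>1 M\<^sub>k\<close>, the partial sums exceed the square root of the index on the long interval
  \<open>[M\<^sub>k, A\<^sub>k\<^sup>2]\<close>, and there the sums of the means gain \<open>A\<^sub>k log (A\<^sub>k\<^sup>2/M\<^sub>k)\<close>, which is of order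
  \<open>(k+1) A\<^sub>k\<close>. This gain is what the factor \<open>k + 1\<close> in \<open>q\<^sub>k\<^sub>+\<^sub>1 = (k+1) A\<^sub>k\<close> spends: it lowers the next
  step so far that the partial sums drop below the square root, by a factor of order \<open>\<surd>(k+1)\<close>, before
  they overtake it again no later than at the index \<open>q\<^sub>k\<^sub>+\<^sub>1\<^sup>2\<close>.\<close>

fun inv_height :: "nat \<Rightarrow> nat" where
  "inv_height 0 = 1"
| "inv_height (Suc k) = inv_height k * 2 ^ Suc k * Suc k"

definition step_mass :: "nat \<Rightarrow> nat" where
  "step_mass k = inv_height k * 2 ^ Suc k"

definition step_end :: "nat \<Rightarrow> nat" where
  "step_end k = inv_height k * step_mass k"

definition step_seq :: "nat \<Rightarrow> real" where
  "step_seq n = 1 / real (inv_height (LEAST k. n < step_end k))"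

lemma inv_height_Suc: "inv_height (Suc k) = step_mass k * Suc k"
  by (simp add: step_mass_def)

lemma inv_height_pos: "0 < inv_height k"
  by (induction k) auto

lemma step_mass_pos: "0 < step_mass k"
  by (simp add: step_mass_def inv_height_pos)

lemma inv_height_le_Suc: "inv_height k \<le> inv_height (Suc k)"
proof -
  have "inv_height k * 1 \<le> inv_height k * (2 ^ Suc k * Suc k)"
    by (intro mult_le_mono2) (simp add: Suc_le_eq del: power_Suc mult_Suc_right)
  then show ?thesis by (simp only: inv_height.simps mult.assoc mult_1_right)
qed

lemma inv_height_mono: "i \<le> j \<Longrightarrow> inv_height i \<le> inv_height j"
  by (rule lift_Suc_mono_le[of inv_height]) (rule inv_height_le_Suc)

lemma step_mass_Suc_ge: "2 * step_mass k \<le> step_mass (Suc k)"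
proof -
  have "(2::nat) ^ 1 \<le> 2 ^ Suc (Suc k)" by (rule power_increasing) auto
  then have "1 * 2 \<le> Suc k * 2 ^ Suc (Suc k)" by (intro mult_le_mono) auto
  then have "step_mass k * (1 * 2) \<le> step_mass k * (Suc k * 2 ^ Suc (Suc k))" by (rule mult_le_mono2)
  then show ?thesis
    by (simp only: step_mass_def[of "Suc k"] inv_height_Suc mult.assoc mult_1_left mult.commute[of 2])
qed

lemma step_end_mono: "i \<le> j \<Longrightarrow> step_end i \<le> step_end j"
proof (rule lift_Suc_mono_le[of step_end])
  fix k show "step_end k \<le> step_end (Suc k)"
    unfolding step_end_def using inv_height_le_Suc[of k] step_mass_Suc_ge[of k] by (intro mult_le_mono) linarith+
qed

lemma less_step_end: "k < step_end k"
proof -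
  have "k < 2 ^ Suc k" using less_exp[of "Suc k"] by simp
  also have "\<dots> = 1 * (1 * 2 ^ Suc k)" by simp
  also have "\<dots> \<le> step_end k"
    unfolding step_end_def step_mass_def using inv_height_pos[of k] by (intro mult_le_mono) auto
  finally show ?thesis .
qed

lemma step_seq_ge:
  assumes "n < step_end k"
  shows "1 / real (inv_height k) \<le> step_seq n"
proof -
  have "(LEAST k. n < step_end k) \<le> k" using assms by (rule Least_le)
  then show ?thesis unfolding step_seq_def
    by (intro divide_left_mono) (auto simp: inv_height_pos inv_height_mono)
qed

lemma step_seq_le:
  assumes "step_end k \<le> n"
  shows "step_seq n \<le> 1 / real (inv_height (Suc k))"
proof -
  define l where "l = (LEAST k. n < step_end k)"
  have "n < step_end l" unfolding l_def by (rule LeastI[of _ n]) (rule less_step_end)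
  then have "Suc k \<le> l" using step_end_mono[of l k] assms by linarith
  then show ?thesis unfolding step_seq_def l_def[symmetric]
    by (intro divide_left_mono) (auto simp: inv_height_pos inv_height_mono simp del: inv_height.simps)
qed

lemma step_seq_c0_star: "step_seq \<in> c0_star"
proof -
  have nonneg: "0 \<le> step_seq n" for n by (simp add: step_seq_def)
  have "step_seq (Suc n) \<le> step_seq n" for n
  proof -
    have "Suc n < step_end (LEAST k. Suc n < step_end k)" by (rule LeastI[of _ "Suc n"]) (rule less_step_end)
    then show ?thesis unfolding step_seq_def[of "Suc n"] by (intro step_seq_ge) simp
  qed
  then have dec: "decseq step_seq" by (rule decseq_SucI)
  have "step_seq \<longlonglongrightarrow> 0"
  proof (rule LIMSEQ_I)
    fix r :: real assume "r > 0"
    obtain k :: nat where k: "inverse (real (Suc k)) < r" using reals_Archimedean[OF \<open>r > 0\<close>] by blast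
    have "norm (step_seq n - 0) < r" if "n \<ge> step_end k" for n
    proof -
      have "1 * Suc k \<le> inv_height (Suc k)"
        unfolding inv_height_Suc using step_mass_pos[of k] by (intro mult_le_mono1) simp
      then have "1 / real (inv_height (Suc k)) \<le> 1 / real (Suc k)"
        by (intro divide_left_mono) (auto simp: inv_height_pos simp del: inv_height.simps)
      then show ?thesis using step_seq_le[OF that] nonneg[of n] k by (simp add: inverse_eq_divide)
    qed
    then show "\<exists>no. \<forall>n\<ge>no. norm (step_seq n - 0) < r" by blast
  qed
  then show ?thesis using nonneg dec by (simp add: c0_star_def)
qed

lemma sum_step_seq_ge:
  assumes "n \<le> step_end k"
  shows "real n / real (inv_height k) \<le> (\<Sum>j<n. step_seq j)"
proof -
  have "(\<Sum>j<n. 1 / real (inv_height k)) \<le> (\<Sum>j<n. step_seq j)"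
    using assms by (intro sum_mono step_seq_ge) simp
  then show ?thesis by simp
qed

lemma step_mass_le_sum_step_seq:
  assumes "step_end k \<le> n"
  shows "real (step_mass k) \<le> (\<Sum>j<n. step_seq j)"
proof -
  have "real (step_mass k) = real (step_end k) / real (inv_height k)"
    using inv_height_pos[of k] by (simp add: step_end_def)
  also have "\<dots> \<le> (\<Sum>j<step_end k. step_seq j)" by (rule sum_step_seq_ge) simp
  also have "\<dots> \<le> (\<Sum>j<n. step_seq j)" by (rule sum_c0_star_mono[OF step_seq_c0_star assms])
  finally show ?thesis .
qed

lemma sum_step_seq_le:
  assumes "step_end k \<le> n" and init: "(\<Sum>j<step_end k. step_seq j) \<le> B"
  shows "(\<Sum>j<n. step_seq j) \<le> B + real n / real (inv_height (Suc k))"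
proof -
  have "(\<Sum>j<n. step_seq j) = (\<Sum>j<step_end k. step_seq j) + (\<Sum>j\<in>{step_end k..<n}. step_seq j)"
    using sum.atLeastLessThan_concat[of 0 "step_end k" n step_seq] assms(1) by (simp add: atLeast0LessThan)
  also have "(\<Sum>j\<in>{step_end k..<n}. step_seq j) \<le> (\<Sum>j\<in>{step_end k..<n}. 1 / real (inv_height (Suc k)))"
    by (intro sum_mono step_seq_le) simp
  also have "\<dots> = real (n - step_end k) / real (inv_height (Suc k))" by simp
  also have "\<dots> \<le> real n / real (inv_height (Suc k))" by (intro divide_right_mono) auto
  finally show ?thesis using init by linarith
qed

lemma sum_step_seq_step_end_le: "(\<Sum>j<step_end k. step_seq j) \<le> 2 * real (step_mass k)"
proof (induction k)
  case 0
  have "step_end 0 = 2" "step_mass 0 = 2" by (simp_all add: step_end_def step_mass_def)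
  moreover have "step_seq j \<le> 1" for j
    by (simp add: step_seq_def inv_height_pos Suc_leI)
  then have "(\<Sum>j<step_end 0. step_seq j) \<le> real (step_end 0)"
    using sum_mono[of "{..<step_end 0}" step_seq "\<lambda>_. 1"] by simp
  ultimately show ?case by simp
next
  case (Suc k)
  have "(\<Sum>j<step_end (Suc k). step_seq j)
      \<le> 2 * real (step_mass k) + real (step_end (Suc k)) / real (inv_height (Suc k))"
    by (rule sum_step_seq_le[OF step_end_mono Suc]) simp
  also have "real (step_end (Suc k)) / real (inv_height (Suc k)) = real (step_mass (Suc k))"
    using inv_height_pos[of "Suc k"] by (simp add: step_end_def del: inv_height.simps)
  also have "2 * real (step_mass k) \<le> real (step_mass (Suc k))"
    using step_mass_Suc_ge[of k] by linarith
  finally show ?case by simp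
qed

text \<open>At the index \<open>N = A\<^sub>k q\<^sub>k\<^sub>+\<^sub>1\<close>, the steps up to \<open>M\<^sub>k\<close> contribute at most \<open>2A\<^sub>k\<close> and the next step
  \<open>A\<^sub>k\<close>, whereas \<open>\<surd>N = A\<^sub>k \<surd>(k+1)\<close>. So the mean is smaller than \<open>1/\<surd>N\<close> by a factor of order
  \<open>\<surd>(k+1)\<close>.\<close>

lemma not_dominated_arith_mean_step_seq:
  "\<not> dominated (\<lambda>n. harmonic_seq n powr (1/2)) (arith_mean step_seq)"
proof
  assume "dominated (\<lambda>n. harmonic_seq n powr (1/2)) (arith_mean step_seq)"
  then obtain C where C: "C > 0"
    "\<And>n. harmonic_seq n powr (1/2) \<le> C * arith_mean step_seq n"
    using dominatedE c0_starD(1)[OF arith_mean_c0_star[OF step_seq_c0_star]] by blast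
  obtain k :: nat where k: "(3 * C)\<^sup>2 < real k" using reals_Archimedean2 by blast
  \<comment> \<open>Here the contribution of step \<open>k + 1\<close> has just caught up with that of the steps before it.\<close>
  define N where "N = step_mass k * inv_height (Suc k)"
  have "N > 0" by (simp add: N_def step_mass_pos inv_height_pos del: inv_height.simps)
  have N_eq: "N = (step_mass k)\<^sup>2 * Suc k" by (simp only: N_def inv_height_Suc power2_eq_square mult.assoc)
  have "step_end k \<le> N"
    unfolding step_end_def N_def using inv_height_le_Suc[of k] by (simp add: mult.commute del: inv_height.simps)
  then have "(\<Sum>j<N. step_seq j) \<le> 2 * real (step_mass k) + real N / real (inv_height (Suc k))"
    by (rule sum_step_seq_le) (rule sum_step_seq_step_end_le)
  also have "\<dots> = 3 * real (step_mass k)"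
    using inv_height_pos[of "Suc k"] by (simp add: N_def del: inv_height.simps)
  finally have S: "(\<Sum>j<N. step_seq j) \<le> 3 * real (step_mass k)" .
  have "1 / sqrt (real N) \<le> C * ((\<Sum>j<N. step_seq j) / real N)"
    using C(2)[of "N - 1"] \<open>N > 0\<close> by (simp add: sqrt_harmonic arith_mean_eq)
  also have "\<dots> \<le> C * (3 * real (step_mass k) / real N)"
    using S C(1) by (intro mult_left_mono divide_right_mono) auto
  finally have "real N / sqrt (real N) \<le> 3 * C * real (step_mass k)"
    using \<open>N > 0\<close> by (simp add: field_simps)
  then have "sqrt (real N) \<le> 3 * C * real (step_mass k)"
    by (simp add: real_div_sqrt)
  moreover have "sqrt (real N) = real (step_mass k) * sqrt (real (Suc k))"
    by (simp add: N_eq real_sqrt_mult del: of_nat_Suc mult_Suc_right)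
  ultimately have "real (step_mass k) * sqrt (real (Suc k)) \<le> real (step_mass k) * (3 * C)"
    by (simp add: mult.commute)
  then have "sqrt (real (Suc k)) \<le> 3 * C"
    using step_mass_pos[of k] by (simp del: of_nat_Suc)
  then have "(sqrt (real (Suc k)))\<^sup>2 \<le> (3 * C)\<^sup>2" by (rule power_mono) simp
  then show False using k by simp
qed

lemma sum_inverse_dyadic_ge:
  assumes "M > 0"
  shows "real L / 2 \<le> (\<Sum>i\<in>{M..<M * 2 ^ L}. 1 / real (Suc i))"
proof (induction L)
  case (Suc L)
  let ?a = "M * 2 ^ L"
  have "?a > 0" using assms by simp
  have "(\<Sum>i\<in>{?a..<2 * ?a}. 1 / real (2 * ?a)) \<le> (\<Sum>i\<in>{?a..<2 * ?a}. 1 / real (Suc i))"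
    using \<open>?a > 0\<close> by (intro sum_mono divide_left_mono) (simp_all only: of_nat_le_iff, auto)
  moreover have "(\<Sum>i\<in>{?a..<2 * ?a}. 1 / real (2 * ?a)) = 1 / 2"
    using \<open>?a > 0\<close> assms by simp
  moreover have "(\<Sum>i\<in>{M..<2 * ?a}. 1 / real (Suc i))
      = (\<Sum>i\<in>{M..<?a}. 1 / real (Suc i)) + (\<Sum>i\<in>{?a..<2 * ?a}. 1 / real (Suc i))"
    by (rule sum.atLeastLessThan_concat[symmetric]) auto
  moreover have "real (Suc L) / 2 = real L / 2 + 1 / 2" by (simp add: field_simps)
  ultimately have "real (Suc L) / 2 \<le> (\<Sum>i\<in>{M..<2 * ?a}. 1 / real (Suc i))"
    using Suc.IH by linarith
  moreover have "M * 2 ^ Suc L = 2 * ?a" by simp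
  ultimately show ?case by (simp only:)
qed simp

text \<open>Let \<open>M\<^sub>k < n \<le> M\<^sub>k\<^sub>+\<^sub>1\<close>. If \<open>n \<le> A\<^sub>k\<^sup>2\<close> or \<open>n \<ge> q\<^sub>k\<^sub>+\<^sub>1\<^sup>2\<close>, then the partial sum of the sequence
  itself reaches \<open>\<surd>n\<close>, and the sum of the means is at least as large because the means decrease.
  Between these two bounds the partial sums can be too small, but \<open>\<surd>n < q\<^sub>k\<^sub>+\<^sub>1 = (k+1) A\<^sub>k\<close>, and the
  means over \<open>[M\<^sub>k, A\<^sub>k\<^sup>2]\<close> already contribute half of that.\<close>

lemma sum_arith_mean_step_seq_ge:
  assumes "n > 0"
  shows "sqrt (real n) / 2 \<le> (\<Sum>i<n. arith_mean step_seq i)"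
proof -
  let ?S = "\<lambda>n. \<Sum>j<n. step_seq j" and ?T = "\<Sum>i<n. arith_mean step_seq i"
  have S_le_T: "?S n \<le> ?T"
  proof -
    obtain m where m: "n = Suc m" using assms gr0_conv_Suc by blast
    show ?thesis
      using le_arith_mean[OF arith_mean_c0_star[OF step_seq_c0_star], of m]
      unfolding m arith_mean_eq[of _ m] by (simp add: divide_le_cancel del: of_nat_Suc sum.lessThan_Suc)
  qed
  show ?thesis
  proof (cases "n \<le> step_end 0")
    case True
    have "n * 1 \<le> n * n" using assms by (intro mult_le_mono2) simp
    then have "real n \<le> real (n * n)" by (simp only: of_nat_le_iff mult_1_right)
    then have "sqrt (real n) \<le> real n"
      by (intro real_le_lsqrt) (simp_all only: power2_eq_square of_nat_mult of_nat_0_le_iff)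
    also have "\<dots> \<le> ?S n" using sum_step_seq_ge[OF True] by simp
    finally show ?thesis using S_le_T real_sqrt_ge_zero[of "real n"] by linarith
  next
    case False
    define l where "l = (LEAST k. n \<le> step_end k)"
    have n_le: "n \<le> step_end l" unfolding l_def
      by (rule LeastI[of "\<lambda>k. n \<le> step_end k" n]) (rule less_imp_le[OF less_step_end])
    then have "l \<noteq> 0" using False by metis
    then obtain k where l: "l = Suc k" using not0_implies_Suc by blast
    have n_gt: "step_end k < n"
      using not_less_Least[of k "\<lambda>k. n \<le> step_end k"] l unfolding l_def by simp
    consider "n \<le> (step_mass k)\<^sup>2" | "(inv_height l)\<^sup>2 \<le> n" | "(step_mass k)\<^sup>2 < n" "n < (inv_height l)\<^sup>2" by linarith
    then show ?thesis
    proof cases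
      case 1
      then have "real n \<le> (real (step_mass k))\<^sup>2"
        unfolding of_nat_power[symmetric] of_nat_le_iff .
      then have "sqrt (real n) \<le> real (step_mass k)" by (simp add: real_le_lsqrt)
      also have "\<dots> \<le> ?S n" using n_gt by (intro step_mass_le_sum_step_seq) simp
      finally show ?thesis using S_le_T real_sqrt_ge_zero[of "real n"] by linarith
    next
      case 2
      then have "(real (inv_height l))\<^sup>2 \<le> real n"
        unfolding of_nat_power[symmetric] of_nat_le_iff .
      then have "real (inv_height l) \<le> sqrt (real n)" by (rule real_le_rsqrt)
      then have "sqrt (real n) * real (inv_height l) \<le> sqrt (real n) * sqrt (real n)"
        by (rule mult_left_mono) simp
      then have "sqrt (real n) * real (inv_height l) \<le> real n" by simp
      then have "sqrt (real n) \<le> real n / real (inv_height l)"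
        using inv_height_pos[of l] by (simp only: pos_le_divide_eq of_nat_0_less_iff)
      also have "\<dots> \<le> ?S n" by (rule sum_step_seq_ge[OF n_le])
      finally show ?thesis using S_le_T real_sqrt_ge_zero[of "real n"] by linarith
    next
      case 3
      have pos: "step_end k > 0" using less_step_end[of k] by simp
      have dyadic: "step_end k * 2 ^ Suc k = (step_mass k)\<^sup>2"
        by (simp add: step_end_def step_mass_def power2_eq_square)
      have "real n \<le> (real (inv_height l))\<^sup>2"
        using less_imp_le[OF 3(2)] unfolding of_nat_power[symmetric] of_nat_le_iff .
      then have "sqrt (real n) \<le> real (inv_height l)" by (simp add: real_le_lsqrt)
      then have "sqrt (real n) / 2 \<le> real (step_mass k) * (real (Suc k) / 2)"
        by (simp add: l inv_height_Suc del: inv_height.simps of_nat_Suc mult_Suc_right)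
      also have "\<dots> \<le> real (step_mass k) * (\<Sum>i\<in>{step_end k..<(step_mass k)\<^sup>2}. 1 / real (Suc i))"
        using sum_inverse_dyadic_ge[OF pos, of "Suc k"] unfolding dyadic
        by (intro mult_left_mono) auto
      also have "\<dots> = (\<Sum>i\<in>{step_end k..<(step_mass k)\<^sup>2}. real (step_mass k) / real (Suc i))"
        by (simp add: sum_distrib_left)
      also have "\<dots> \<le> (\<Sum>i\<in>{step_end k..<(step_mass k)\<^sup>2}. arith_mean step_seq i)"
        unfolding arith_mean_eq
        by (intro sum_mono divide_right_mono step_mass_le_sum_step_seq) auto
      also have "\<dots> \<le> ?T"
        using 3(1) c0_starD(1)[OF arith_mean_c0_star[OF step_seq_c0_star]] by (intro sum_mono2) auto
      finally show ?thesis .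
    qed
  qed
qed

section \<open>The comparison of arithmetic mean ideals\<close>

theorem mainTheorem6:
  assumes "separable_space (euclidean :: 'h::complex_hilbert_space topology)"
    and "infinite_dimensional TYPE('h)"
  shows "\<exists>\<xi>\<in>c0_star.
    am_ideal (am_ideal (principal_ideal (\<lambda>n. harmonic_seq n powr (1/2)))) \<subseteq>
      (am_ideal (am_ideal (principal_ideal \<xi>)) :: ('h \<Rightarrow> 'h) set) \<and>
    \<not> am_ideal (principal_ideal (\<lambda>n. harmonic_seq n powr (1/2))) \<subseteq>
      (am_ideal (principal_ideal \<xi>) :: ('h \<Rightarrow> 'h) set)"
proof (intro bexI conjI)
  let ?r = "\<lambda>n. harmonic_seq n powr (1/2)"
  note inf = assms(2)
  note r = sqrt_harmonic_c0_star and s = step_seq_c0_star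
  note am = am_ideal_principal_ideal[OF inf r] am_ideal_principal_ideal[OF inf s]
    am_ideal_bigo_star[OF inf arith_mean_c0_star[OF r]]
    am_ideal_bigo_star[OF inf arith_mean_c0_star[OF s]]
  note iff = ideal_of_subset_iff[OF inf bigo_star_subset bigo_star_subset]
  have ar: "dominated (arith_mean ?r) ?r"
    unfolding dominated_def using arith_mean_sqrt_harmonic_le by blast
  have "?r n \<le> 2 * arith_mean (arith_mean step_seq) n" for n
  proof -
    have "1 / sqrt (real (Suc n)) = sqrt (real (Suc n)) / real (Suc n)"
      using sqrt_divide_self_eq[of "real (Suc n)"] by (simp add: divide_inverse del: of_nat_Suc)
    also have "\<dots> \<le> 2 * arith_mean (arith_mean step_seq) n"
      using divide_right_mono[OF sum_arith_mean_step_seq_ge[of "Suc n"], of "real (Suc n)"]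
      unfolding arith_mean_eq[of "arith_mean step_seq"]
      by (simp add: field_simps del: of_nat_Suc sum.lessThan_Suc)
    finally show ?thesis by (simp only: sqrt_harmonic)
  qed
  then have "dominated ?r (arith_mean (arith_mean step_seq))"
    unfolding dominated_def by blast
  then have aar: "dominated (arith_mean (arith_mean ?r)) (arith_mean (arith_mean step_seq))"
    using dominated_trans[OF dominated_trans[OF dominated_arith_mean[OF ar] ar]]
      c0_starD(1)[OF r] c0_starD(1)[OF arith_mean_c0_star[OF r]] by blast
  have "bigo_star (arith_mean (arith_mean ?r)) \<subseteq> bigo_star (arith_mean (arith_mean step_seq))"
    unfolding bigo_star_def
    using dominated_trans[OF _ aar] c0_starD(1)[OF arith_mean_c0_star[OF arith_mean_c0_star[OF r]]]
    by blast
  then show "am_ideal (am_ideal (principal_ideal ?r))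
      \<subseteq> (am_ideal (am_ideal (principal_ideal step_seq)) :: ('h \<Rightarrow> 'h) set)"
    unfolding am iff .
  have "?r \<in> bigo_star (arith_mean ?r)"
    unfolding bigo_star_def dominated_def using r le_arith_mean[OF r]
    by (intro CollectI conjI exI[of _ 1]) simp_all
  moreover have "?r \<notin> bigo_star (arith_mean step_seq)"
    using not_dominated_arith_mean_step_seq by (simp add: bigo_star_def)
  ultimately have "\<not> bigo_star (arith_mean ?r) \<subseteq> bigo_star (arith_mean step_seq)" by blast
  then show "\<not> am_ideal (principal_ideal ?r)
      \<subseteq> (am_ideal (principal_ideal step_seq) :: ('h \<Rightarrow> 'h) set)"
    unfolding am iff .
qed (rule step_seq_c0_star)

end
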